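(* Let $A,B\ge 0$ be $n\times n$ complex matrices such that the pair $(A,B)$ is monotone, and let $Z>0$ be an $n\times n$ complex matrix with extremal (largest and smallest) eigenvalues $a$ and $b$. Then there exists a unitary matrix $V$ such that $$|ZAB|\le \frac{a+b}{2\sqrt{ab}}\,V|AZB|V^*.$$
   Context: $A\ge 0$ (resp. $A>0$) means that $A$ is Hermitian positive semidefinite (resp. positive definite), and $X\le Y$ for Hermitian matrices means $Y-X\ge 0$. $|X|=(X^*X)^{1/2}$. A pair $(A,B)$ of Hermitian matrices is monotone if there exist a Hermitian matrix $C$ and two nondecreasing real functions $f,g$ such that $A=f(C)$ and $B=g(C)$ (functional calculus). *)

theory Defs
  imports "Jordan_Normal_Form.Schur_Decomposition"
begin

definition hermitian_mat :: "complex mat \<Rightarrow> bool" where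
  "hermitian_mat A \<longleftrightarrow> mat_adjoint A = A"

definition unitary_mat :: "complex mat \<Rightarrow> bool" where
  "unitary_mat U \<longleftrightarrow> square_mat U \<and>
     U * mat_adjoint U = 1\<^sub>m (dim_row U) \<and> mat_adjoint U * U = 1\<^sub>m (dim_row U)"

definition psd_mat :: "complex mat \<Rightarrow> bool" where
  "psd_mat A \<longleftrightarrow> hermitian_mat A \<and>
     (\<forall>v \<in> carrier_vec (dim_row A). 0 \<le> Re ((A *\<^sub>v v) \<bullet>c v))"

definition pd_mat :: "complex mat \<Rightarrow> bool" where
  "pd_mat A \<longleftrightarrow> hermitian_mat A \<and>
     (\<forall>v \<in> carrier_vec (dim_row A). v \<noteq> 0\<^sub>v (dim_row A) \<longrightarrow> 0 < Re ((A *\<^sub>v v) \<bullet>c v))"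

text \<open>The order is only meant for Hermitian matrices of the same size, so both
  requirements are part of the relation (matrix subtraction is total on \<^typ>\<open>complex mat\<close>).\<close>

definition loewner_le :: "complex mat \<Rightarrow> complex mat \<Rightarrow> bool" where
  "loewner_le X Y \<longleftrightarrow> dim_row X = dim_row Y \<and> hermitian_mat X \<and> hermitian_mat Y \<and> psd_mat (Y - X)"

definition spectral_decomp :: "complex mat \<Rightarrow> complex mat \<Rightarrow> (nat \<Rightarrow> real) \<Rightarrow> bool" where
  "spectral_decomp C U d \<longleftrightarrow> unitary_mat U \<and> dim_row U = dim_row C \<and>
     C = U * mat_diag (dim_row C) (\<lambda>i. complex_of_real (d i)) * mat_adjoint U"

text \<open>Functional calculus for a Hermitian matrix: apply \<open>f\<close> to the eigenvalues in any unitary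
  diagonalisation. The result does not depend on the diagonalisation, see
  \<open>spectral_decomp_unique\<close> and \<open>herm_fun_eq\<close> below.\<close>

definition herm_fun :: "(real \<Rightarrow> real) \<Rightarrow> complex mat \<Rightarrow> complex mat" where
  "herm_fun f C = (THE M. \<exists>U d. spectral_decomp C U d \<and>
     M = U * mat_diag (dim_row C) (\<lambda>i. complex_of_real (f (d i))) * mat_adjoint U)"

definition mat_abs :: "complex mat \<Rightarrow> complex mat" where
  "mat_abs X = herm_fun sqrt (mat_adjoint X * X)"

definition monotone_pair :: "complex mat \<Rightarrow> complex mat \<Rightarrow> bool" where
  "monotone_pair A B \<longleftrightarrow> hermitian_mat A \<and> hermitian_mat B \<and>
     (\<exists>C f g. hermitian_mat C \<and> dim_row C = dim_row A \<and> mono f \<and> mono g \<and>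
        A = herm_fun f C \<and> B = herm_fun g C)"

lemma mat_adjoint_carrier:
  "A \<in> carrier_mat m n \<Longrightarrow> mat_adjoint A \<in> carrier_mat n m"
  unfolding mat_adjoint_def mat_of_rows_def by auto

lemma mat_diag_carrier: "mat_diag n f \<in> carrier_mat n n"
  by simp

lemma spectral_decomp_unique:
  assumes U: "spectral_decomp C U d" and W: "spectral_decomp C W e"
  shows "U * mat_diag (dim_row C) (\<lambda>i. complex_of_real (f (d i))) * mat_adjoint U =
         W * mat_diag (dim_row C) (\<lambda>i. complex_of_real (f (e i))) * mat_adjoint W"
proof -
  define n where "n = dim_row C"
  define D where "D = (\<lambda>h::real \<Rightarrow> real. mat_diag n (\<lambda>i. complex_of_real (h (d i))))"
  define E where "E = (\<lambda>h::real \<Rightarrow> real. mat_diag n (\<lambda>i. complex_of_real (h (e i))))"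
  define U' where "U' = mat_adjoint U"
  define W' where "W' = mat_adjoint W"
  have cU: "U \<in> carrier_mat n n" and cW: "W \<in> carrier_mat n n"
    using U W by (auto simp: spectral_decomp_def unitary_mat_def n_def)
  have cU': "U' \<in> carrier_mat n n" and cW': "W' \<in> carrier_mat n n"
    using mat_adjoint_carrier cU cW by (auto simp: U'_def W'_def)
  have cD: "D h \<in> carrier_mat n n" and cE: "E h \<in> carrier_mat n n" for h
    by (auto simp: D_def E_def)
  have UU: "U * U' = 1\<^sub>m n" "U' * U = 1\<^sub>m n" and WW: "W * W' = 1\<^sub>m n" "W' * W = 1\<^sub>m n"
    using U W cU cW by (auto simp: spectral_decomp_def unitary_mat_def U'_def W'_def)
  have eq: "U * D (\<lambda>x. x) * U' = W * E (\<lambda>x. x) * W'"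
    using U W by (simp add: spectral_decomp_def D_def E_def U'_def W'_def n_def)
  define X where "X = W' * U"
  have cX: "X \<in> carrier_mat n n" using cW' cU by (simp add: X_def)
  have WX: "W * X = U" 
    using WW cU cW cW' by (simp add: X_def assoc_mult_mat[symmetric, of _ n n _ n _ n])
  have XU: "X * U' = W'" 
    using UU cU cU' cW' by (simp add: X_def assoc_mult_mat[of _ n n _ n _ n])
  have "W' * (U * D (\<lambda>x. x) * U') * U = X * D (\<lambda>x. x) * (U' * U)"
    unfolding X_def using cU cU' cW' cD[of "\<lambda>x. x"] 
    by (simp add: assoc_mult_mat[of _ n n _ n _ n])
  also have "\<dots> = X * D (\<lambda>x. x)" using UU cX cD[of "\<lambda>x. x"] by simp
  finally have 1: "W' * (U * D (\<lambda>x. x) * U') * U = X * D (\<lambda>x. x)" .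
  have "W' * (W * E (\<lambda>x. x) * W') * U = (W' * W) * E (\<lambda>x. x) * X"
    unfolding X_def using cU cW cW' cE[of "\<lambda>x. x"] 
    by (simp add: assoc_mult_mat[of _ n n _ n _ n])
  also have "\<dots> = E (\<lambda>x. x) * X" using WW cX cE[of "\<lambda>x. x"] by simp
  finally have 2: "X * D (\<lambda>x. x) = E (\<lambda>x. x) * X" using 1 eq by simp
  have XD: "(X * D h) $$ (i,j) = X $$ (i,j) * complex_of_real (h (d j))"
    and EX: "(E h * X) $$ (i,j) = complex_of_real (h (e i)) * X $$ (i,j)"
    if "i < n" "j < n" for i j h
    using that cX by (auto simp: D_def E_def mat_diag_mult_left[OF cX] mat_diag_mult_right[OF cX])
  have "X * D f = E f * X"
  proof (rule eq_matI)
    fix i j assume "i < dim_row (E f * X)" "j < dim_col (E f * X)"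
    hence ij: "i < n" "j < n" using cE[of f] cX by auto
    have "X $$ (i,j) * complex_of_real (d j) = complex_of_real (e i) * X $$ (i,j)"
      using XD[OF ij, of "\<lambda>x. x"] EX[OF ij, of "\<lambda>x. x"] 2 by metis
    hence "X $$ (i,j) = 0 \<or> d j = e i"
      by (metis mult.commute mult_cancel_left of_real_eq_iff)
    thus "(X * D f) $$ (i,j) = (E f * X) $$ (i,j)"
      using XD[OF ij, of f] EX[OF ij, of f] by auto
  qed (use cX cD[of f] cE[of f] in auto)
  hence "W * (X * D f) * U' = W * (E f * X) * U'" by simp
  hence "(W * X) * D f * U' = W * E f * (X * U')"
    using cW cX cU' cD[of f] cE[of f] by (simp add: assoc_mult_mat[of _ n n _ n _ n])
  thus ?thesis unfolding WX XU by (simp add: D_def E_def U'_def W'_def n_def)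
qed

lemma herm_fun_eq:
  assumes "spectral_decomp C U d"
  shows "herm_fun f C = U * mat_diag (dim_row C) (\<lambda>i. complex_of_real (f (d i))) * mat_adjoint U"
  unfolding herm_fun_def
proof (rule the_equality)
  fix M
  assume "\<exists>U d. spectral_decomp C U d \<and>
     M = U * mat_diag (dim_row C) (\<lambda>i. complex_of_real (f (d i))) * mat_adjoint U"
  thus "M = U * mat_diag (dim_row C) (\<lambda>i. complex_of_real (f (d i))) * mat_adjoint U"
    using spectral_decomp_unique[OF _ assms] by blast
qed (use assms in blast)

end

theory Submission
  imports Defs
begin

text \<open>
  Put \<open>K = (a + b) / (2 sqrt (a b))\<close>. For a vector \<open>x\<close> and \<open>u = ABx = BAx\<close>, three inequalities
  combine: Cauchy--Schwarz gives
  \<open>\<langle>Zu, u\<rangle> = \<langle>AZB(Ax), Bx\<rangle> \<le> \<parallel>AZB(Ax)\<parallel> \<parallel>Bx\<parallel>\<close>,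
  Kantorovich gives \<open>\<parallel>Zu\<parallel> \<parallel>u\<parallel> \<le> K \<langle>Zu, u\<rangle>\<close>,
  and Chebyshev's inequality for the monotone pair gives
  \<open>\<parallel>Ax\<parallel> \<parallel>Bx\<parallel> \<le> \<parallel>x\<parallel> \<parallel>u\<parallel>\<close>.
  Hence \<open>\<parallel>ZABx\<parallel> \<parallel>Ax\<parallel> \<le> K \<parallel>x\<parallel> \<parallel>AZB(Ax)\<parallel>\<close>: if \<open>ZAB\<close> expands a
  \<open>k\<close>-dimensional space \<open>S\<close> by at least \<open>s > 0\<close>, then \<open>AZB\<close> expands the \<open>k\<close>-dimensional
  space \<open>A S\<close> by at least \<open>s / K\<close>. So the ordered singular values satisfy
  \<open>s\<^sub>k(ZAB) \<le> K s\<^sub>k(AZB)\<close>, and \<open>V\<close> matches the two ordered singular bases.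
\<close>

section \<open>The spectral theorem\<close>

lemma dim_mat_adjoint [simp]:
  "dim_row (mat_adjoint A) = dim_col A" "dim_col (mat_adjoint A) = dim_row A"
  by (simp_all add: mat_adjoint_def)

lemma index_mat_adjoint [simp]:
  fixes A :: "complex mat"
  assumes "i < dim_col A" "j < dim_row A"
  shows "mat_adjoint A $$ (i, j) = cnj (A $$ (j, i))"
  using assms by (simp add: mat_adjoint_def mat_of_rows_index)

lemma mat_adjoint_adjoint [simp]: "mat_adjoint (mat_adjoint A) = (A :: complex mat)"
  by (rule eq_matI) auto

lemma mat_adjoint_mult:
  fixes A B :: "complex mat"
  assumes "A \<in> carrier_mat m n" "B \<in> carrier_mat n p"
  shows "mat_adjoint (A * B) = mat_adjoint B * mat_adjoint A"
  using assms by (intro eq_matI) (auto simp: scalar_prod_def mult.commute intro!: sum.cong)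

lemma mat_adjoint_mat_diag_of_real [simp]:
  "mat_adjoint (mat_diag n (\<lambda>i. complex_of_real (d i))) = mat_diag n (\<lambda>i. complex_of_real (d i))"
  by (rule eq_matI) (auto simp: mat_diag_def)

lemma unitary_matD:
  assumes "unitary_mat U" "U \<in> carrier_mat n n"
  shows "U * mat_adjoint U = 1\<^sub>m n" "mat_adjoint U * U = 1\<^sub>m n"
  using assms by (auto simp: unitary_mat_def)

text \<open>A left inverse of a square matrix is also a right inverse, so one of the two equations
  suffices.\<close>

lemma unitary_matI:
  assumes U: "U \<in> carrier_mat n n" and "mat_adjoint U * U = 1\<^sub>m n"
  shows "unitary_mat U"
  using mat_mult_left_right_inverse[OF mat_adjoint_carrier[OF U] U] assms
  by (auto simp: unitary_mat_def)

lemma unitary_mat_adjoint: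
  assumes "unitary_mat U" "U \<in> carrier_mat n n"
  shows "unitary_mat (mat_adjoint U)"
  using unitary_matD[OF assms] assms
    by (intro unitary_matI[of _ n]) (auto simp: mat_adjoint_carrier)

lemma unitary_mat_mult:
  assumes U: "unitary_mat U" "U \<in> carrier_mat n n"
    and V: "unitary_mat V" "V \<in> carrier_mat n n"
  shows "unitary_mat (U * V)"
proof (rule unitary_matI[of _ n])
  note [simp] = mat_adjoint_carrier[OF U(2)] mat_adjoint_carrier[OF V(2)]
  have "mat_adjoint (U * V) * (U * V) = mat_adjoint V * (mat_adjoint U * U) * V"
    using U V mult_carrier_mat[OF mat_adjoint_carrier[OF U(2)] U(2)]
    by (simp add: mat_adjoint_mult[of _ n n _ n] assoc_mult_mat[of _ n n _ n _ n])
  thus "mat_adjoint (U * V) * (U * V) = 1\<^sub>m n"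
    using unitary_matD[OF U] unitary_matD[OF V] V by simp
qed (use U V in auto)

lemma inner_mult_mat_vec:
  fixes A :: "complex mat"
  assumes "A \<in> carrier_mat m n" "v \<in> carrier_vec n" "w \<in> carrier_vec m"
  shows "(A *\<^sub>v v) \<bullet>c w = v \<bullet>c (mat_adjoint A *\<^sub>v w)"
proof -
  have "(A *\<^sub>v v) \<bullet>c w = (\<Sum>i<m. \<Sum>j<n. A $$ (i,j) * v $ j * cnj (w $ i))"
    using assms by (auto simp: scalar_prod_def sum_distrib_right atLeast0LessThan intro!: sum.cong)
  also have "\<dots> = (\<Sum>j<n. \<Sum>i<m. A $$ (i,j) * v $ j * cnj (w $ i))"
    by (rule sum.swap)
  also have "\<dots> = v \<bullet>c (mat_adjoint A *\<^sub>v w)"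
    using assms by (auto simp: scalar_prod_def sum_distrib_left atLeast0LessThan algebra_simps
        intro!: sum.cong)
  finally show ?thesis .
qed

section \<open>Unitary diagonalisation of Hermitian matrices\<close>

lemma hermitian_eigenvalue_real:
  assumes A: "A \<in> carrier_mat n n" and h: "hermitian_mat A" and e: "eigenvalue A e"
  shows "e \<in> \<real>"
proof -
  from e obtain v where v: "v \<in> carrier_vec n" "v \<noteq> 0\<^sub>v n" "A *\<^sub>v v = e \<cdot>\<^sub>v v"
    using A by (auto simp: eigenvalue_def eigenvector_def)
  have "e * (v \<bullet>c v) = (A *\<^sub>v v) \<bullet>c v" using v by simp
  also have "\<dots> = v \<bullet>c (A *\<^sub>v v)"
    using inner_mult_mat_vec[OF A v(1) v(1)] h by (simp add: hermitian_mat_def)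
  also have "\<dots> = cnj e * (v \<bullet>c v)" using v by (simp add: conjugate_smult_vec)
  finally have "e = cnj e" using v by simp
  thus ?thesis by (simp add: Reals_cnj_iff)
qed

text \<open>The deflation step of the diagonalisation: an eigenvector is completed to a basis,
  Gram-Schmidt keeps it in first place, and the vectors are then normalised.\<close>

lemma ex_unitary_with_eigenvector_col:
  assumes A: "(A :: complex mat) \<in> carrier_mat n n" and e: "eigenvalue A e"
  shows "\<exists>W \<in> carrier_mat n n. unitary_mat W \<and> A *\<^sub>v col W 0 = e \<cdot>\<^sub>v col W 0"
proof -
  from e obtain v where v: "v \<in> carrier_vec n" and v0: "v \<noteq> 0\<^sub>v n"
    and ev: "A *\<^sub>v v = e \<cdot>\<^sub>v v"
    using A by (auto simp: eigenvalue_def eigenvector_def)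
  define b where "b = basis_completion v"
  define ws where "ws = gram_schmidt n b"
  have n: "0 < n" using v v0 by (cases n) auto
  interpret cof_vec_space n "TYPE(complex)" .
  from basis_completion[OF v v0, folded b_def]
  have b: "distinct b" "\<not> lin_dep (set b)" "set b \<subseteq> carrier_vec n" "hd b = v" "length b = n"
    by auto
  with n obtain vs where bv: "b = v # vs" by (cases b) auto
  have ws: "set ws \<subseteq> carrier_vec n" "corthogonal ws" "length ws = n"
    using gram_schmidt_result[OF b(3,1,2) ws_def] b by auto
  have "hd ws = v" using gram_schmidt_hd[OF v, of vs] bv ws_def by simp
  hence ws0: "ws ! 0 = v" using ws n by (metis hd_conv_nth list.size(3) nat_less_le)
  \<comment> \<open>The vectors \<open>ws\<close> are orthogonal but not normalised;
    \<open>r i\<close> is the squared norm of the \<open>i\<close>-th one, kept as a real number so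
    that its root can be taken.\<close>
  define r where "r i = (\<Sum>k<n. (cmod ((ws ! i) $ k))\<^sup>2)" for i
  have wsi: "ws ! i \<in> carrier_vec n" if "i < n" for i using ws that by auto
  have rr: "ws ! i \<bullet>c ws ! i = of_real (r i)" if "i < n" for i
    using wsi[OF that] by (simp add: scalar_prod_def r_def atLeast0LessThan complex_norm_square
        flip: of_real_power)
  have r: "r i > 0" if "i < n" for i
  proof -
    have "r i \<ge> 0" by (auto simp: r_def intro: sum_nonneg)
    moreover have "r i \<noteq> 0"
      using rr[OF that] corthogonalD[OF ws(2), of i i] that ws(3) by auto
    ultimately show ?thesis by simp
  qed
  define W where "W = mat n n (\<lambda>(k, i). complex_of_real (1 / sqrt (r i)) * (ws ! i) $ k)"
  have W: "W \<in> carrier_mat n n" by (simp add: W_def)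
  have "mat_adjoint W * W = 1\<^sub>m n"
  proof (rule eq_matI)
    fix i j assume "i < dim_row (1\<^sub>m n :: complex mat)" "j < dim_col (1\<^sub>m n :: complex mat)"
    hence ij: "i < n" "j < n" by auto
    have "(mat_adjoint W * W) $$ (i, j) =
        (\<Sum>k<n. cnj (complex_of_real (1 / sqrt (r i)) * (ws ! i) $ k) *
          (complex_of_real (1 / sqrt (r j)) * (ws ! j) $ k))"
      using ij W by (auto simp: scalar_prod_def W_def atLeast0LessThan intro!: sum.cong)
    also have "\<dots> = complex_of_real (1 / sqrt (r i) * (1 / sqrt (r j))) * (ws ! j \<bullet>c ws ! i)"
      using wsi[OF ij(1)] wsi[OF ij(2)]
      by (auto simp: scalar_prod_def atLeast0LessThan sum_distrib_left intro!: sum.cong)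
    also have "\<dots> = 1\<^sub>m n $$ (i, j)"
    proof (cases "i = j")
      case True
      thus ?thesis using rr[OF ij(1)] r[OF ij(1)] ij
        by (simp flip: of_real_mult of_real_divide)
    next
      case False
      thus ?thesis using corthogonalD[OF ws(2), of j i] ij ws(3) by auto
    qed
    finally show "(mat_adjoint W * W) $$ (i, j) = 1\<^sub>m n $$ (i, j)" .
  qed (use W in auto)
  hence uW: "unitary_mat W" by (rule unitary_matI[OF W])
  \<comment> \<open>Normalising only rescales \<open>v\<close>, so the first column is still an
    eigenvector for \<open>e\<close>.\<close>
  have "col W 0 = complex_of_real (1 / sqrt (r 0)) \<cdot>\<^sub>v v"
    using n v by (intro eq_vecI) (auto simp: W_def ws0)
  hence "A *\<^sub>v col W 0 = e \<cdot>\<^sub>v col W 0"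
    using ev A v by (simp add: mult_mat_vec smult_smult_assoc mult.commute)
  with W uW show ?thesis by blast
qed

text \<open>Induction on the list of roots: a unitary change of basis splits off the first root and
  leaves a smaller Hermitian block with the remaining ones. The diagonal follows the order of
  \<open>es\<close>, so any ordering of the eigenvalues can be prescribed.\<close>

lemma hermitian_unitary_diagonalisation:
  assumes "A \<in> carrier_mat n n" "hermitian_mat A" "char_poly A = (\<Prod>e\<leftarrow>es. [:- e, 1:])"
  shows "\<exists>U \<in> carrier_mat n n. unitary_mat U \<and> A = U * mat_diag n (\<lambda>i. es ! i) * mat_adjoint U"
  using assms
proof (induction es arbitrary: n A)
  case Nil
  with degree_monic_char_poly[of A n] have n: "n = 0" by simp
  show ?case using Nil(1) unfolding n
    by (intro bexI[of _ "1\<^sub>m 0"] conjI unitary_matI[of _ 0]) (auto intro!: eq_matI)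
next
  case (Cons e es)
  note A = Cons.prems(1)
  have cp: "char_poly A = [:- e, 1:] * (\<Prod>e\<leftarrow>es. [:- e, 1:])"
    using Cons.prems by simp
  have e: "eigenvalue A e" unfolding eigenvalue_root_char_poly[OF A] cp by simp
  have n: "n \<noteq> 0" using eigenvalue_imp_nonzero_dim[OF A e] by simp
  define m where "m = n - 1"
  have nm: "n = Suc m" using n by (simp add: m_def)
  obtain W where W: "W \<in> carrier_mat n n" and uW: "unitary_mat W"
    and eW: "A *\<^sub>v col W 0 = e \<cdot>\<^sub>v col W 0"
    using ex_unitary_with_eigenvector_col[OF A e] by blast
  define W' where "W' = mat_adjoint W"
  have W': "W' \<in> carrier_mat n n" using mat_adjoint_carrier[OF W] by (simp add: W'_def)
  have WW: "W * W' = 1\<^sub>m n" "W' * W = 1\<^sub>m n"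
    using unitary_matD[OF uW W] by (auto simp: W'_def)
  define H where "H = W' * A * W"
  have H: "H \<in> carrier_mat n n" using W W' A by (simp add: H_def)
  have hH: "mat_adjoint H = H"
    using A W W' Cons.prems(2)
    by (simp add: H_def W'_def mat_adjoint_mult[of _ n n _ n] assoc_mult_mat[of _ n n _ n _ n] hermitian_mat_def)
  \<comment> \<open>The first column of \<open>W\<close> is an eigenvector, so the first column of
    \<open>H\<close> is \<open>e\<close> times the first unit vector; Hermiticity then carries the
    zeros to the first row.\<close>
  have H0: "H $$ (i, 0) = (if i = 0 then e else 0)" if "i < n" for i
  proof -
    have "H = W' * (A * W)" using A W W' by (simp add: H_def assoc_mult_mat[of _ n n _ n _ n])
    hence "H $$ (i, 0) = row W' i \<bullet> col (A * W) 0" using A W W' that n by simp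
    also have "\<dots> = row W' i \<bullet> (A *\<^sub>v col W 0)"
      using col_mult2[OF A W, of 0] n by (metis neq0_conv)
    also have "\<dots> = e * (row W' i \<bullet> col W 0)" unfolding eW using W W' n
      by (simp add: scalar_prod_def sum_distrib_left algebra_simps)
    also have "row W' i \<bullet> col W 0 = (W' * W) $$ (i, 0)" using W W' that n by simp
    finally show ?thesis unfolding WW using that n by simp
  qed
  have H0': "H $$ (0, i) = (if i = 0 then e else 0)" if "i < n" for i
  proof (cases "i = 0")
    case False
    have "H $$ (0, i) = cnj (H $$ (i, 0))"
      using that n H index_mat_adjoint[of 0 H i] unfolding hH by simp
    thus ?thesis using H0[OF that] False by simp
  qed (use H0 n in auto)
  define H3 where "H3 = mat m m (\<lambda>(i, j). H $$ (Suc i, Suc j))"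
  have H3: "H3 \<in> carrier_mat m m" by (simp add: H3_def)
  define E where "E = mat 1 1 (\<lambda>_. e)"
  have E: "E \<in> carrier_mat 1 1" by (simp add: E_def)
  have Hb: "H = four_block_mat E (0\<^sub>m 1 m) (0\<^sub>m m 1) H3"
    using H H0 H0' nm by (intro eq_matI) (auto simp: E_def H3_def)
  have hH3: "hermitian_mat H3" unfolding hermitian_mat_def
  proof (rule eq_matI)
    fix i j assume "i < dim_row H3" "j < dim_col H3"
    thus "mat_adjoint H3 $$ (i, j) = H3 $$ (i, j)"
      using index_mat_adjoint[of "Suc i" H "Suc j"] H nm unfolding hH by (simp add: H3_def)
  qed (simp_all add: H3_def)
  have "similar_mat_wit H A W' W"
    by (rule similar_mat_witI[OF WW(2,1) H_def H A W' W])
  hence "similar_mat H A" unfolding similar_mat_def by blast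
  hence "char_poly H = [:- e, 1:] * (\<Prod>e\<leftarrow>es. [:- e, 1:])"
    using char_poly_similar cp by metis
  also have "char_poly H = char_poly E * char_poly H3"
    unfolding Hb by (rule char_poly_four_block_zeros_col[OF E _ H3]) simp
  also have "char_poly E = [:- e, 1:]" by (simp add: E_def char_poly_defs det_def sign_def)
  finally have "char_poly H3 = (\<Prod>e\<leftarrow>es. [:- e, 1:])"
    by (metis mult_cancel_left pCons_eq_0_iff zero_neq_one)
  from Cons.IH[OF H3 hH3 this] obtain U3 where U3: "U3 \<in> carrier_mat m m"
    and uU3: "unitary_mat U3"
    and H3eq: "H3 = U3 * mat_diag m (\<lambda>i. es ! i) * mat_adjoint U3" by blast
  \<comment> \<open>The direct sum of the 1 by 1 identity and \<open>X\<close>; it lifts the unitary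
    matrix for the block \<open>H3\<close> to size \<open>n\<close> and leaves the split-off
    eigenvalue untouched.\<close>
  define F where "F = (\<lambda>X :: complex mat. four_block_mat (1\<^sub>m 1) (0\<^sub>m 1 m) (0\<^sub>m m 1) X)"
  have F: "F X \<in> carrier_mat n n" if "X \<in> carrier_mat m m" for X
    using that nm by (auto simp: F_def)
  have Fadj: "mat_adjoint (F X) = F (mat_adjoint X)" if "X \<in> carrier_mat m m" for X
    using that by (intro eq_matI) (auto simp: F_def)
  have Fmult: "F X * four_block_mat Y (0\<^sub>m 1 m) (0\<^sub>m m 1) X' = four_block_mat Y (0\<^sub>m 1 m) (0\<^sub>m m 1) (X * X')"
    if "X \<in> carrier_mat m m" "X' \<in> carrier_mat m m" "Y \<in> carrier_mat 1 1" for X X' Y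
    using that unfolding F_def
    by (subst mult_four_block_mat[of _ 1 1 _ m _ m _ _ 1 _ m]) auto
  have Fmult': "four_block_mat Y (0\<^sub>m 1 m) (0\<^sub>m m 1) X' * F X = four_block_mat Y (0\<^sub>m 1 m) (0\<^sub>m m 1) (X' * X)"
    if "X \<in> carrier_mat m m" "X' \<in> carrier_mat m m" "Y \<in> carrier_mat 1 1" for X X' Y
    using that unfolding F_def
    by (subst mult_four_block_mat[of _ 1 1 _ m _ m _ _ 1 _ m]) auto
  have U3': "mat_adjoint U3 \<in> carrier_mat m m" using mat_adjoint_carrier[OF U3] .
  have F1: "F (1\<^sub>m m) = 1\<^sub>m n" using nm by (intro eq_matI) (auto simp: F_def)
  have uF: "unitary_mat (F U3)"
  proof (rule unitary_matI[OF F[OF U3]])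
    have "F (mat_adjoint U3) * F U3 = F (mat_adjoint U3 * U3)"
      using Fmult[OF U3' U3, of "1\<^sub>m 1"] unfolding F_def by simp
    thus "mat_adjoint (F U3) * F U3 = 1\<^sub>m n"
      unfolding Fadj[OF U3] unitary_matD[OF uU3 U3] F1 .
  qed
  have D: "mat_diag n (\<lambda>i. (e # es) ! i) = four_block_mat E (0\<^sub>m 1 m) (0\<^sub>m m 1) (mat_diag m (\<lambda>i. es ! i))"
    unfolding nm by (intro eq_matI) (auto simp: E_def mat_diag_def nth_Cons')
  have HF: "H = F U3 * mat_diag n (\<lambda>i. (e # es) ! i) * mat_adjoint (F U3)"
    unfolding D Hb H3eq Fadj[OF U3] using U3 U3' E
    by (simp add: Fmult Fmult' mult_carrier_mat[of _ m m _ m] del: One_nat_def)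
  define U where "U = W * F U3"
  have U: "U \<in> carrier_mat n n" using W F[OF U3] by (simp add: U_def)
  have "W * H * W' = (W * W') * A * (W * W')"
    using A W W' by (simp add: H_def assoc_mult_mat[of _ n n _ n _ n])
  hence "A = W * H * W'" using WW A by simp
  also have "\<dots> = U * mat_diag n (\<lambda>i. (e # es) ! i) * mat_adjoint U"
    using W W' F[OF U3] mat_adjoint_carrier[OF F[OF U3]]
    by (simp add: HF U_def W'_def mat_adjoint_mult[of _ n n _ n] assoc_mult_mat[of _ n n _ n _ n]
        mult_carrier_mat[of _ n n _ n])
  finally show ?case using U unitary_mat_mult[OF uW W uF F[OF U3]] unfolding U_def by blast
qed

text \<open>The roots are sorted by decreasing real part before diagonalising; they are real, so
  taking real parts loses nothing. The ordering is what lets the \<open>k\<close>-th eigenvalues of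
  two matrices be compared.\<close>

lemma hermitian_spectral_decomp_sorted:
  assumes A: "A \<in> carrier_mat n n" and h: "hermitian_mat A"
  obtains U d where "spectral_decomp A U d" "antimono_on {..<n} d"
proof -
  from char_poly_factorized[OF A] obtain as
    where as: "char_poly A = (\<Prod>a\<leftarrow>as. [:- a, 1:])" "length as = n" by blast
  define es where "es = sort_key (\<lambda>a. - Re a) as"
  have mset: "mset es = mset as" by (simp add: es_def)
  have len: "length es = n" using as mset by (metis size_mset)
  have cp: "char_poly A = (\<Prod>a\<leftarrow>es. [:- a, 1:])"
    using as(1) mset by (metis mset_map prod_mset_prod_list)
  obtain U where U: "U \<in> carrier_mat n n" "unitary_mat U"
    and eq: "A = U * mat_diag n (\<lambda>i. es ! i) * mat_adjoint U"
    using hermitian_unitary_diagonalisation[OF A h cp] by blast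
  have "es ! i = complex_of_real (Re (es ! i))" if "i < n" for i
  proof -
    have "poly (char_poly A) (es ! i) = 0" unfolding cp poly_prod_list prod_list_zero_iff
      using that len by (force simp: image_iff in_set_conv_nth)
    hence "eigenvalue A (es ! i)" using eigenvalue_root_char_poly[OF A] by simp
    from hermitian_eigenvalue_real[OF A h this] show ?thesis by (simp add: of_real_Re)
  qed
  hence "mat_diag n (\<lambda>i. es ! i) = mat_diag n (\<lambda>i. complex_of_real (Re (es ! i)))"
    by (intro eq_matI) (auto simp: mat_diag_def)
  hence "spectral_decomp A U (\<lambda>i. Re (es ! i))"
    using U A eq by (auto simp: spectral_decomp_def)
  moreover have "antimono_on {..<n} (\<lambda>i. Re (es ! i))"
  proof (rule monotone_onI)
    fix i j assume "i \<in> {..<n}" "j \<in> {..<n}" "i \<le> j"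
    moreover have "sorted (map (\<lambda>a. - Re a) es)" by (simp add: es_def)
    ultimately show "Re (es ! j) \<le> Re (es ! i)"
      using sorted_nth_mono[of "map (\<lambda>a. - Re a) es" i j] len by simp
  qed
  ultimately show thesis by (rule that)
qed

section \<open>Norms and quadratic forms\<close>

text \<open>The squared Euclidean norm. Estimating squares postpones roots to the final comparison
  of singular values, and the constant enters as \<open>K\<^sup>2\<close> until then.\<close>

definition vec_norm2 :: "complex vec \<Rightarrow> real" where
  "vec_norm2 v = (\<Sum>i<dim_vec v. (cmod (v $ i))\<^sup>2)"

lemma vec_norm2_nonneg [simp]: "0 \<le> vec_norm2 v"
  by (auto simp: vec_norm2_def intro: sum_nonneg)

lemma vec_norm2_zero [simp]: "vec_norm2 (0\<^sub>v n) = 0"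
  by (simp add: vec_norm2_def)

lemma mult_mat_zero_vec: "X \<in> carrier_mat m n \<Longrightarrow> X *\<^sub>v 0\<^sub>v n = (0\<^sub>v m :: complex vec)"
  by (intro eq_vecI) auto

lemma cscalar_prod_self: "v \<bullet>c v = complex_of_real (vec_norm2 v)"
  by (simp add: vec_norm2_def scalar_prod_def atLeast0LessThan complex_norm_square del: of_real_power)

lemma vec_norm2_pos:
  assumes "v \<in> carrier_vec n" "v \<noteq> 0\<^sub>v n"
  shows "0 < vec_norm2 v"
proof -
  have "vec_norm2 v \<noteq> 0" using assms cscalar_prod_self[of v] by auto
  thus ?thesis using vec_norm2_nonneg[of v] by linarith
qed

section \<open>Cauchy-Schwarz, Chebyshev and Kantorovich inequalities for finite sums\<close>

text \<open>Lagrange's identity: the double sum of \<open>(f i * g j - f j * g i)\<^sup>2\<close> is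
  twice the difference of the two sides.\<close>

lemma cauchy_schwarz_sum:
  fixes f g :: "nat \<Rightarrow> real"
  shows "(\<Sum>i<n. f i * g i)\<^sup>2 \<le> (\<Sum>i<n. (f i)\<^sup>2) * (\<Sum>i<n. (g i)\<^sup>2)"
proof -
  have "0 \<le> (\<Sum>i<n. \<Sum>j<n. (f i * g j - f j * g i)\<^sup>2)"
    by (intro sum_nonneg) simp
  also have "\<dots> = (\<Sum>i<n. \<Sum>j<n. (f i)\<^sup>2 * (g j)\<^sup>2) + (\<Sum>i<n. \<Sum>j<n. (g i)\<^sup>2 * (f j)\<^sup>2)
      - 2 * (\<Sum>i<n. \<Sum>j<n. (f i * g i) * (f j * g j))"
    by (simp add: power2_diff sum.distrib sum_subtractf sum_distrib_left power_mult_distrib algebra_simps)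
  also have "\<dots> = 2 * ((\<Sum>i<n. (f i)\<^sup>2) * (\<Sum>i<n. (g i)\<^sup>2)) - 2 * (\<Sum>i<n. f i * g i)\<^sup>2"
    using sum.swap[of "\<lambda>i j. (f j)\<^sup>2 * (g i)\<^sup>2" "{..<n}" "{..<n}"]
    by (simp add: sum_product power2_eq_square[of "sum _ _"] mult.commute)
  finally show ?thesis by simp
qed

lemma cauchy_schwarz_cscalar:
  assumes "v \<in> carrier_vec n" "w \<in> carrier_vec n"
  shows "(cmod (v \<bullet>c w))\<^sup>2 \<le> vec_norm2 v * vec_norm2 w"
proof -
  have "cmod (v \<bullet>c w) \<le> (\<Sum>i<n. cmod (v $ i) * cmod (w $ i))"
    using assms norm_sum[of "\<lambda>i. v $ i * cnj (w $ i)" "{..<n}"]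
    by (simp add: scalar_prod_def atLeast0LessThan norm_mult)
  hence "(cmod (v \<bullet>c w))\<^sup>2 \<le> (\<Sum>i<n. cmod (v $ i) * cmod (w $ i))\<^sup>2"
    by (intro power_mono) auto
  also have "\<dots> \<le> vec_norm2 v * vec_norm2 w"
    using cauchy_schwarz_sum assms by (simp add: vec_norm2_def)
  finally show ?thesis .
qed

text \<open>Twice the difference of the two sides is the double sum of
  \<open>p i * p j * ((f i - f j) * (g i - g j))\<close>, whose terms are all nonnegative.\<close>

lemma chebyshev_weighted:
  fixes p f g :: "nat \<Rightarrow> real"
  assumes "\<And>i. i < n \<Longrightarrow> 0 \<le> p i"
    and "\<And>i j. i < n \<Longrightarrow> j < n \<Longrightarrow> 0 \<le> (f i - f j) * (g i - g j)"
  shows "(\<Sum>i<n. f i * p i) * (\<Sum>i<n. g i * p i) \<le> (\<Sum>i<n. p i) * (\<Sum>i<n. f i * g i * p i)"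
proof -
  have "0 \<le> (\<Sum>i<n. \<Sum>j<n. p i * p j * ((f i - f j) * (g i - g j)))"
    using assms by (intro sum_nonneg) (metis lessThan_iff mult_nonneg_nonneg)
  also have "\<dots> = (\<Sum>i<n. \<Sum>j<n. p i * (f j * g j * p j)) + (\<Sum>i<n. \<Sum>j<n. (f i * g i * p i) * p j)
      - (\<Sum>i<n. \<Sum>j<n. (f i * p i) * (g j * p j)) - (\<Sum>i<n. \<Sum>j<n. (g i * p i) * (f j * p j))"
    by (simp add: sum.distrib sum_subtractf algebra_simps)
  also have "\<dots> = 2 * ((\<Sum>i<n. p i) * (\<Sum>i<n. f i * g i * p i))
      - 2 * ((\<Sum>i<n. f i * p i) * (\<Sum>i<n. g i * p i))"
    unfolding sum_product[symmetric] by simp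
  finally show ?thesis by simp
qed

text \<open>Summing \<open>(a - f i) * (f i - b) * p i\<close>, which is nonnegative, gives
  \<open>?N + ?P \<le> ?Q\<close>; then \<open>4 * (?P * ?N) \<le> (?N + ?P)\<^sup>2\<close>. The
  sign of \<open>a * b\<close> makes \<open>?P\<close> nonnegative, so the first inequality may be
  squared.\<close>

lemma kantorovich_weighted:
  fixes p f :: "nat \<Rightarrow> real"
  assumes "\<And>i. i < n \<Longrightarrow> 0 \<le> p i" "\<And>i. i < n \<Longrightarrow> b \<le> f i \<and> f i \<le> a" "0 \<le> a * b"
  shows "4 * (a * b) * ((\<Sum>i<n. p i) * (\<Sum>i<n. (f i)\<^sup>2 * p i)) \<le> ((a + b) * (\<Sum>i<n. f i * p i))\<^sup>2"
proof -
  let ?N = "\<Sum>i<n. (f i)\<^sup>2 * p i" and ?P = "a * b * (\<Sum>i<n. p i)"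
    and ?Q = "(a + b) * (\<Sum>i<n. f i * p i)"
  have "0 \<le> (\<Sum>i<n. (a - f i) * (f i - b) * p i)"
    using assms by (intro sum_nonneg mult_nonneg_nonneg) auto
  also have "\<dots> = ?Q - ?N - ?P"
    by (simp add: sum_distrib_left sum_distrib_right sum.distrib sum_subtractf algebra_simps power2_eq_square)
  finally have le: "?N + ?P \<le> ?Q" by simp
  have nn: "0 \<le> ?N" "0 \<le> ?P" using assms by (auto intro!: sum_nonneg mult_nonneg_nonneg)
  have "4 * (?P * ?N) \<le> (?N + ?P)\<^sup>2" using zero_le_power2[of "?N - ?P"]
    by (simp add: power2_eq_square algebra_simps)
  also have "\<dots> \<le> ?Q\<^sup>2" using le nn by (intro power_mono) auto
  finally show ?thesis by (simp add: algebra_simps)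
qed

section \<open>Norms and quadratic forms in an eigenbasis\<close>

lemma vec_norm2_mult_mat_vec:
  assumes X: "X \<in> carrier_mat m n" and v: "v \<in> carrier_vec n"
  shows "vec_norm2 (X *\<^sub>v v) = Re ((mat_adjoint X * X *\<^sub>v v) \<bullet>c v)"
proof -
  have "complex_of_real (vec_norm2 (X *\<^sub>v v)) = v \<bullet>c (mat_adjoint X *\<^sub>v (X *\<^sub>v v))"
    using inner_mult_mat_vec[OF X v, of "X *\<^sub>v v"] X v by (simp add: cscalar_prod_self)
  also have "\<dots> = v \<bullet>c (mat_adjoint X * X *\<^sub>v v)"
    using X v mat_adjoint_carrier[OF X] by (simp add: assoc_mult_mat_vec[of _ n m _ n])
  also have "\<dots> = (mat_adjoint X * X *\<^sub>v v) \<bullet>c v"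
    using X v inner_mult_mat_vec[of "mat_adjoint X * X" n n v v] mat_adjoint_carrier[OF X]
    by (simp add: mat_adjoint_mult[OF mat_adjoint_carrier[OF X] X])
  finally show ?thesis by (metis Re_complex_of_real)
qed

lemma vec_norm2_unitary:
  assumes "unitary_mat U" "U \<in> carrier_mat n n" "v \<in> carrier_vec n"
  shows "vec_norm2 (U *\<^sub>v v) = vec_norm2 v"
  using vec_norm2_mult_mat_vec[OF assms(2,3)] unitary_matD[OF assms(1,2)] assms(3)
  by (simp add: cscalar_prod_self)

lemma mat_diag_mult_vec:
  assumes "v \<in> carrier_vec n"
  shows "mat_diag n f *\<^sub>v v = vec n (\<lambda>i. f i * v $ i)"
proof (rule eq_vecI)
  fix i assume "i < dim_vec (vec n (\<lambda>i. f i * v $ i))"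
  hence i: "i < n" by simp
  have "(mat_diag n f *\<^sub>v v) $ i = (\<Sum>j<n. (if i = j then f j else 0) * v $ j)"
    using i assms by (simp add: mat_diag_def scalar_prod_def atLeast0LessThan)
  also have "\<dots> = (\<Sum>j<n. if i = j then f j * v $ j else 0)" by (rule sum.cong) auto
  finally show "(mat_diag n f *\<^sub>v v) $ i = vec n (\<lambda>i. f i * v $ i) $ i"
    using i by simp
qed (simp add: mat_diag_def)

lemma spectral_decompD:
  assumes "spectral_decomp C U d" "C \<in> carrier_mat n n"
  shows "U \<in> carrier_mat n n" "unitary_mat U"
    "C = U * mat_diag n (\<lambda>i. complex_of_real (d i)) * mat_adjoint U"
  using assms by (auto simp: spectral_decomp_def unitary_mat_def)

text \<open>For unitary \<open>U\<close>, the spectral weights of \<open>v\<close> along the columns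
  of \<open>U\<close>. They turn quadratic forms into weighted sums over eigenvalues, the shape that
  the scalar inequalities take.\<close>

definition eig_weight :: "complex mat \<Rightarrow> complex vec \<Rightarrow> nat \<Rightarrow> real" where
  "eig_weight U v i = (cmod ((mat_adjoint U *\<^sub>v v) $ i))\<^sup>2"

lemma eig_weight_nonneg [simp]: "0 \<le> eig_weight U v i"
  by (simp add: eig_weight_def)

lemma sum_eig_weight:
  assumes "unitary_mat U" "U \<in> carrier_mat n n" "v \<in> carrier_vec n"
  shows "(\<Sum>i<n. eig_weight U v i) = vec_norm2 v"
  using vec_norm2_unitary[OF unitary_mat_adjoint[OF assms(1,2)] mat_adjoint_carrier[OF assms(2)] assms(3)]
    assms(2) by (simp add: vec_norm2_def eig_weight_def)

lemma quadratic_form_diag: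
  assumes U: "U \<in> carrier_mat n n" and v: "v \<in> carrier_vec n"
    and C: "C = U * mat_diag n (\<lambda>i. complex_of_real (d i)) * mat_adjoint U"
  shows "(C *\<^sub>v v) \<bullet>c v = complex_of_real (\<Sum>i<n. d i * eig_weight U v i)"
proof -
  define D where "D = mat_diag n (\<lambda>i. complex_of_real (d i))"
  define w where "w = mat_adjoint U *\<^sub>v v"
  have D: "D \<in> carrier_mat n n" by (simp add: D_def)
  have w: "w \<in> carrier_vec n" using mat_adjoint_carrier[OF U] v by (simp add: w_def)
  have "C *\<^sub>v v = U *\<^sub>v (D *\<^sub>v w)"
    using U D v mat_adjoint_carrier[OF U]
    by (simp add: C D_def[symmetric] w_def assoc_mult_mat_vec[of _ n n _ n])
  hence "(C *\<^sub>v v) \<bullet>c v = (D *\<^sub>v w) \<bullet>c w"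
    using inner_mult_mat_vec[OF U, of "D *\<^sub>v w" v] D w v by (simp add: w_def)
  also have "\<dots> = (\<Sum>i<n. complex_of_real (d i) * (w $ i * cnj (w $ i)))"
    unfolding D_def mat_diag_mult_vec[OF w] using w
    by (simp add: scalar_prod_def atLeast0LessThan mult.assoc)
  also have "\<dots> = complex_of_real (\<Sum>i<n. d i * eig_weight U v i)"
    by (simp add: eig_weight_def w_def complex_norm_square del: of_real_power)
  finally show ?thesis .
qed

text \<open>The factor \<open>mat_adjoint U * U\<close> cancels in the middle. This yields squares
  of a matrix as well as products of two matrices with a common eigenbasis.\<close>

lemma spectral_mult:
  assumes U: "unitary_mat U" "U \<in> carrier_mat n n"
  shows "(U * mat_diag n f * mat_adjoint U) * (U * mat_diag n g * mat_adjoint U)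
    = U * mat_diag n (\<lambda>i. f i * g i) * mat_adjoint U"
proof -
  note c = U(2) mat_adjoint_carrier[OF U(2)] mat_diag_dim[of n f] mat_diag_dim[of n g]
  have "(U * mat_diag n f * mat_adjoint U) * (U * mat_diag n g * mat_adjoint U)
    = U * (mat_diag n f * ((mat_adjoint U * U) * (mat_diag n g * mat_adjoint U)))"
    using c by (simp add: assoc_mult_mat[of _ n n _ n _ n] mult_carrier_mat[of _ n n _ n])
  also have "\<dots> = U * ((mat_diag n f * mat_diag n g) * mat_adjoint U)"
    using c unitary_matD[OF U]
    by (simp add: assoc_mult_mat[of _ n n _ n _ n] mult_carrier_mat[of _ n n _ n]
        left_mult_one_mat[of _ n n] del: mat_diag_diag)
  finally show ?thesis using c
    by (simp add: assoc_mult_mat[of _ n n _ n _ n] mult_carrier_mat[of _ n n _ n])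
qed

lemma hermitian_spectral:
  assumes U: "U \<in> carrier_mat n n"
  shows "hermitian_mat (U * mat_diag n (\<lambda>i. complex_of_real (d i)) * mat_adjoint U)"
proof -
  note c = U mat_adjoint_carrier[OF U] mat_diag_dim[of n "\<lambda>i. complex_of_real (d i)"]
  show ?thesis unfolding hermitian_mat_def
    using c by (simp add: mat_adjoint_mult[of _ n n _ n] assoc_mult_mat[of _ n n _ n _ n]
        mult_carrier_mat[of _ n n _ n])
qed

lemma vec_norm2_spectral:
  assumes U: "unitary_mat U" "U \<in> carrier_mat n n" and v: "v \<in> carrier_vec n"
    and C: "C = U * mat_diag n (\<lambda>i. complex_of_real (d i)) * mat_adjoint U"
  shows "vec_norm2 (C *\<^sub>v v) = (\<Sum>i<n. (d i)\<^sup>2 * eig_weight U v i)"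
proof -
  have cC: "C \<in> carrier_mat n n" using U mat_adjoint_carrier[OF U(2)]
    by (simp add: C mult_carrier_mat[of _ n n _ n])
  have "mat_adjoint C = C" using hermitian_spectral[OF U(2)] by (simp add: C hermitian_mat_def)
  hence "mat_adjoint C * C = U * mat_diag n (\<lambda>i. complex_of_real ((d i)\<^sup>2)) * mat_adjoint U"
    using spectral_mult[OF U] by (simp add: C power2_eq_square)
  from quadratic_form_diag[OF U(2) v this] show ?thesis
    by (simp add: vec_norm2_mult_mat_vec[OF cC v])
qed

text \<open>The identity \<open>C * U = U * D\<close> read column by column; it allows a quadratic
  form to be tested on single eigenvectors.\<close>

lemma unitary_diag_col:
  assumes U: "unitary_mat U" "U \<in> carrier_mat n n" and i: "i < n"
    and C: "C = U * mat_diag n (\<lambda>i. complex_of_real (d i)) * mat_adjoint U"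
  shows "C *\<^sub>v col U i = complex_of_real (d i) \<cdot>\<^sub>v col U i" "vec_norm2 (col U i) = 1"
proof -
  define D where "D = mat_diag n (\<lambda>i. complex_of_real (d i))"
  have c: "D \<in> carrier_mat n n" "U \<in> carrier_mat n n" "mat_adjoint U \<in> carrier_mat n n"
    using U mat_adjoint_carrier[OF U(2)] by (auto simp: D_def)
  have ui: "unit_vec n i \<in> carrier_vec n" by simp
  have colU: "col U i = U *\<^sub>v unit_vec n i" 
    using c i by (intro eq_vecI) (auto simp: scalar_prod_right_unit)
  have "C *\<^sub>v col U i = C * U *\<^sub>v unit_vec n i"
    using c by (simp add: colU C D_def[symmetric] assoc_mult_mat_vec[of _ n n _ n])
  also have "C * U = U * D * (mat_adjoint U * U)"
    using c by (simp add: C D_def[symmetric] assoc_mult_mat[of _ n n _ n _ n])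
  also have "\<dots> = U * D" using c unitary_matD[OF U] by simp
  also have "U * D *\<^sub>v unit_vec n i = U *\<^sub>v (complex_of_real (d i) \<cdot>\<^sub>v unit_vec n i)"
  proof -
    have "D *\<^sub>v unit_vec n i = complex_of_real (d i) \<cdot>\<^sub>v unit_vec n i"
      unfolding D_def mat_diag_mult_vec[OF ui] using i by (intro eq_vecI) (auto simp: unit_vec_def)
    thus ?thesis using c by (simp add: assoc_mult_mat_vec[of _ n n _ n])
  qed
  finally show "C *\<^sub>v col U i = complex_of_real (d i) \<cdot>\<^sub>v col U i"
    using c by (simp add: colU mult_mat_vec)
  have "vec_norm2 (unit_vec n i) = 1"
    using i by (simp add: vec_norm2_def unit_vec_def if_distrib[of "\<lambda>x. (cmod x)\<^sup>2"] cong: if_cong)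
  thus "vec_norm2 (col U i) = 1" unfolding colU using vec_norm2_unitary[OF U ui] by simp
qed

section \<open>Comparison of singular values\<close>

text \<open>The conditions on \<open>v\<close> are \<open>n - 1\<close> homogeneous linear equations; the missing \<open>k\<close>-th one is
  replaced by a zero row, so that the resulting square matrix is singular.\<close>

lemma ex_vec_vanishing_coords:
  assumes M: "(M :: complex mat) \<in> carrier_mat n n" and k: "k < n"
  obtains v where "v \<in> carrier_vec n" "v \<noteq> 0\<^sub>v n"
    "\<And>i. k < i \<Longrightarrow> i < n \<Longrightarrow> v $ i = 0" "\<And>j. j < k \<Longrightarrow> (M *\<^sub>v v) $ j = 0"
proof -
  \<comment> \<open>Rows before \<open>k\<close> read off the coordinates of
    \<open>M *\<^sub>v v\<close>, rows after \<open>k\<close> the coordinates of \<open>v\<close>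
    itself.\<close>
  define c where "c = (\<lambda>j. if j < k then row M j else unit_vec n j)"
  define N where "N = mat\<^sub>r n n (\<lambda>j. if j = k then 0\<^sub>v n else c j)"
  have N: "N \<in> carrier_mat n n" by (simp add: N_def)
  have rows: "row N j = (if j = k then 0\<^sub>v n else c j)" if "j < n" for j
    using that M unfolding N_def by (intro eq_vecI) (auto simp: c_def)
  have "det N = 0" unfolding N_def using M by (intro det_row_0 k) (auto simp: c_def)
  then obtain v where v: "v \<in> carrier_vec n" "v \<noteq> 0\<^sub>v n" "N *\<^sub>v v = 0\<^sub>v n"
    using det_0_iff_vec_prod_zero[OF N] by blast
  have z: "row N j \<bullet> v = 0" if "j < n" for j
    using arg_cong[OF v(3), of "\<lambda>u. u $ j"] that N by simp
  show thesis
  proof (rule that[OF v(1,2)])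
    fix i assume "k < i" "i < n"
    thus "v $ i = 0" using z[of i] rows[of i] v(1) by (simp add: c_def)
  next
    fix j assume "j < k"
    thus "(M *\<^sub>v v) $ j = 0" using z[of j] rows[of j] M k by (simp add: c_def)
  qed
qed

text \<open>The min-max comparison: \<open>x\<close> is taken in the span of the top \<open>k + 1\<close> eigenvectors of \<open>X\<^sup>*X\<close>
  with \<open>Tx\<close> orthogonal to the top \<open>k\<close> eigenvectors of \<open>Y\<^sup>*Y\<close>. Indices start at 0.\<close>

lemma spectral_le_of_norm_le:
  assumes X: "X \<in> carrier_mat n n" and Y: "Y \<in> carrier_mat n n"
    and T: "T \<in> carrier_mat n n"
    and U: "spectral_decomp (mat_adjoint X * X) U d"
      and W: "spectral_decomp (mat_adjoint Y * Y) W e"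
    and d: "antimono_on {..<n} d" and e: "antimono_on {..<n} e"
    and K: "0 \<le> K"
    and inj: "\<And>x. x \<in> carrier_vec n \<Longrightarrow> T *\<^sub>v x = 0\<^sub>v n \<Longrightarrow> X *\<^sub>v x = 0\<^sub>v n"
    and le: "\<And>x. x \<in> carrier_vec n \<Longrightarrow>
      vec_norm2 (X *\<^sub>v x) * vec_norm2 (T *\<^sub>v x) \<le> K * (vec_norm2 x * vec_norm2 (Y *\<^sub>v (T *\<^sub>v x)))"
    and k: "k < n"
  shows "d k \<le> K * e k"
proof -
  have cXX: "mat_adjoint X * X \<in> carrier_mat n n" "mat_adjoint Y * Y \<in> carrier_mat n n"
    using X Y mat_adjoint_carrier by auto
  note U = spectral_decompD[OF U cXX(1)] and W = spectral_decompD[OF W cXX(2)]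
  have W': "mat_adjoint W \<in> carrier_mat n n" using mat_adjoint_carrier[OF W(1)] .
  \<comment> \<open>This matrix expresses \<open>T\<close> in the two eigenbases: it sends
    coordinates of \<open>x\<close> along \<open>U\<close> to coordinates of the image under
    \<open>T\<close> along \<open>W\<close>.\<close>
  have M: "mat_adjoint W * (T * U) \<in> carrier_mat n n" using W' T U(1) by auto
  obtain v where v: "v \<in> carrier_vec n" "v \<noteq> 0\<^sub>v n"
    and vi: "\<And>i. k < i \<Longrightarrow> i < n \<Longrightarrow> v $ i = 0"
    and vj: "\<And>j. j < k \<Longrightarrow> (mat_adjoint W * (T * U) *\<^sub>v v) $ j = 0"
    using ex_vec_vanishing_coords[OF M k] by blast
  define x where "x = U *\<^sub>v v"
  define y where "y = T *\<^sub>v x"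
  have x: "x \<in> carrier_vec n"
    and y: "y \<in> carrier_vec n" using U(1) T v by (auto simp: x_def y_def)
  have Ux: "mat_adjoint U *\<^sub>v x = v"
    using unitary_matD[OF U(2,1)] U(1) v mat_adjoint_carrier[OF U(1)]
    by (simp add: x_def flip: assoc_mult_mat_vec[of _ n n _ n])
  have Wy: "mat_adjoint W *\<^sub>v y = mat_adjoint W * (T * U) *\<^sub>v v"
    using W' T U(1) v
      by (simp add: x_def y_def assoc_mult_mat_vec[of _ n n _ n] mult_carrier_mat[of _ n n _ n])
  have x0: "0 < vec_norm2 x"
    using vec_norm2_unitary[OF U(2,1) v(1)] vec_norm2_pos[OF v] by (simp add: x_def)
  \<comment> \<open>Only weights with \<open>i \<le> k\<close> survive, and there
    \<open>d k \<le> d i\<close>.\<close>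
  have "d k * vec_norm2 x = (\<Sum>i<n. d k * eig_weight U x i)"
    by (simp add: sum_eig_weight[OF U(2,1) x, symmetric] sum_distrib_left)
  also have "\<dots> \<le> (\<Sum>i<n. d i * eig_weight U x i)"
  proof (rule sum_mono)
    fix i assume i: "i \<in> {..<n}"
    show "d k * eig_weight U x i \<le> d i * eig_weight U x i"
    proof (cases "i \<le> k")
      case True thus ?thesis using monotone_onD[OF d, of i k] k by (intro mult_right_mono) auto
    next
      case False thus ?thesis using vi[of i] i by (simp add: eig_weight_def Ux)
    qed
  qed
  also have "\<dots> = vec_norm2 (X *\<^sub>v x)"
    using quadratic_form_diag[OF U(1) x U(3)] vec_norm2_mult_mat_vec[OF X x] by simp
  finally have dX: "d k * vec_norm2 x \<le> vec_norm2 (X *\<^sub>v x)" .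
  \<comment> \<open>Dually, only weights with \<open>k \<le> i\<close> survive, and there
    \<open>e i \<le> e k\<close>.\<close>
  have "vec_norm2 (Y *\<^sub>v y) = (\<Sum>i<n. e i * eig_weight W y i)"
    using quadratic_form_diag[OF W(1) y W(3)] vec_norm2_mult_mat_vec[OF Y y] by simp
  also have "\<dots> \<le> (\<Sum>i<n. e k * eig_weight W y i)"
  proof (rule sum_mono)
    fix i assume i: "i \<in> {..<n}"
    show "e i * eig_weight W y i \<le> e k * eig_weight W y i"
    proof (cases "k \<le> i")
      case True thus ?thesis using monotone_onD[OF e, of k i] i k by (intro mult_right_mono) auto
    next
      case False thus ?thesis using vj[of i] by (simp add: eig_weight_def Wy)
    qed
  qed
  also have "\<dots> = e k * vec_norm2 y"
    by (simp add: sum_eig_weight[OF W(2,1) y, symmetric] sum_distrib_left)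
  finally have eY: "vec_norm2 (Y *\<^sub>v y) \<le> e k * vec_norm2 y" .
  \<comment> \<open>The eigenvalue \<open>e k\<close> is the squared norm of
    \<open>Y *\<^sub>v col W k\<close>.\<close>
  have e0: "0 \<le> e k"
    using vec_norm2_mult_mat_vec[OF Y, of "col W k"] unitary_diag_col[OF W(2,1) k W(3)] W(1) k
      vec_norm2_nonneg[of "Y *\<^sub>v col W k"] by (simp add: cscalar_prod_self)
  show ?thesis
  proof (cases "d k \<le> 0")
    case True
    thus ?thesis using e0 K by (meson mult_nonneg_nonneg order_trans)
  next
    case False
    hence "0 < vec_norm2 (X *\<^sub>v x)" using dX x0 by (meson less_le_trans mult_pos_pos not_le)
    hence "y \<noteq> 0\<^sub>v n" using inj[OF x] by (auto simp: y_def)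
    hence y0: "0 < vec_norm2 y" using vec_norm2_pos[OF y] by simp
    have "d k * vec_norm2 x * vec_norm2 y \<le> vec_norm2 (X *\<^sub>v x) * vec_norm2 y"
      using dX by (intro mult_right_mono) auto
    also have "\<dots> \<le> K * (vec_norm2 x * vec_norm2 (Y *\<^sub>v y))"
      using le[OF x] by (simp add: y_def)
    also have "\<dots> \<le> K * (vec_norm2 x * (e k * vec_norm2 y))"
      using eY K by (intro mult_left_mono) auto
    finally have "d k * (vec_norm2 x * vec_norm2 y) \<le> (K * e k) * (vec_norm2 x * vec_norm2 y)"
      by (simp add: algebra_simps)
    thus ?thesis using x0 y0 by simp
  qed
qed

section \<open>Monotone pairs and the Kantorovich inequality\<close>

text \<open>One diagonalisation of the common matrix \<open>C\<close> serves both \<open>A\<close>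
  and \<open>B\<close>. Their eigenvalues are nondecreasing functions of those of \<open>C\<close>,
  hence vary in the same direction; nonnegativity comes from testing on the columns of
  \<open>U\<close>.\<close>

lemma monotone_pair_simultaneous_diag:
  assumes A: "A \<in> carrier_mat n n" and pA: "psd_mat A" and pB: "psd_mat B"
    and AB: "monotone_pair A B"
  obtains U f g where "U \<in> carrier_mat n n" "unitary_mat U"
    "A = U * mat_diag n (\<lambda>i. complex_of_real (f i)) * mat_adjoint U"
    "B = U * mat_diag n (\<lambda>i. complex_of_real (g i)) * mat_adjoint U"
    "\<And>i. i < n \<Longrightarrow> 0 \<le> f i" "\<And>i. i < n \<Longrightarrow> 0 \<le> g i"
    "\<And>i j. i < n \<Longrightarrow> j < n \<Longrightarrow> 0 \<le> (f i - f j) * (g i - g j)"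
proof -
  from AB obtain C \<phi> \<psi> where h: "hermitian_mat C" and dC: "dim_row C = dim_row A"
    and mono: "mono \<phi>" "mono \<psi>" and eq: "A = herm_fun \<phi> C" "B = herm_fun \<psi> C"
    by (auto simp: monotone_pair_def)
  have rC: "dim_row C = n" using dC A by simp
  have "dim_col C = n" using rC h dim_mat_adjoint(1)[of C] by (simp add: hermitian_mat_def)
  hence C: "C \<in> carrier_mat n n" using rC by auto
  obtain U c where sd: "spectral_decomp C U c" and "antimono_on {..<n} c"
    by (rule hermitian_spectral_decomp_sorted[OF C h])
  note U = spectral_decompD(1,2)[OF sd C]
  have Ae: "A = U * mat_diag n (\<lambda>i. complex_of_real (\<phi> (c i))) * mat_adjoint U"
    and Be: "B = U * mat_diag n (\<lambda>i. complex_of_real (\<psi> (c i))) * mat_adjoint U"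
    using herm_fun_eq[OF sd] eq rC by auto
  have nonneg: "0 \<le> d i" if "psd_mat M" "M = U * mat_diag n (\<lambda>i. complex_of_real (d i)) * mat_adjoint U" "i < n"
    for M d i
  proof -
    have "dim_row M = n" "col U i \<in> carrier_vec n" using that(2) U by auto
    hence "0 \<le> Re ((M *\<^sub>v col U i) \<bullet>c col U i)"
      using that(1) by (simp add: psd_mat_def)
    thus ?thesis using unitary_diag_col[OF U(2,1) that(3,2)] \<open>col U i \<in> _\<close>
      by (simp add: cscalar_prod_self)
  qed
  have "0 \<le> (\<phi> (c i) - \<phi> (c j)) * (\<psi> (c i) - \<psi> (c j))" for i j
    using monoD[OF mono(1), of "c i" "c j"] monoD[OF mono(2), of "c i" "c j"]
      monoD[OF mono(1), of "c j" "c i"] monoD[OF mono(2), of "c j" "c i"]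
    by (cases "c i \<le> c j") (auto intro: mult_nonneg_nonneg mult_nonpos_nonpos)
  thus thesis using that[OF U Ae Be] nonneg[OF pA Ae] nonneg[OF pB Be] by blast
qed

text \<open>In the common eigenbasis this is \<open>chebyshev_weighted\<close> for the squared
  eigenvalues, weighted by \<open>eig_weight U x\<close>.\<close>

lemma monotone_pair_chebyshev:
  assumes A: "A \<in> carrier_mat n n" and B: "B \<in> carrier_mat n n"
    and "psd_mat A" "psd_mat B" "monotone_pair A B" and x: "x \<in> carrier_vec n"
  shows "vec_norm2 (A *\<^sub>v x) * vec_norm2 (B *\<^sub>v x) \<le> vec_norm2 x * vec_norm2 (A *\<^sub>v (B *\<^sub>v x))"
proof -
  from monotone_pair_simultaneous_diag[OF A assms(3-5)] obtain U f g where U: "U \<in> carrier_mat n n" "unitary_mat U"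
    and Ae: "A = U * mat_diag n (\<lambda>i. complex_of_real (f i)) * mat_adjoint U"
    and Be: "B = U * mat_diag n (\<lambda>i. complex_of_real (g i)) * mat_adjoint U"
    and nn: "\<And>i. i < n \<Longrightarrow> 0 \<le> f i" "\<And>i. i < n \<Longrightarrow> 0 \<le> g i"
    and sync: "\<And>i j. i < n \<Longrightarrow> j < n \<Longrightarrow> 0 \<le> (f i - f j) * (g i - g j)" by metis
  have ABe: "A * B = U * mat_diag n (\<lambda>i. complex_of_real (f i * g i)) * mat_adjoint U"
    using spectral_mult[OF U(2,1)] by (simp add: Ae Be)
  \<comment> \<open>Squaring keeps the two sequences similarly ordered because their terms are
    nonnegative.\<close>
  have sync2: "0 \<le> ((f i)\<^sup>2 - (f j)\<^sup>2) * ((g i)\<^sup>2 - (g j)\<^sup>2)" if "i < n" "j < n" for i j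
  proof -
    have "0 \<le> (f i + f j) * (g i + g j)" using nn that by simp
    hence "0 \<le> (f i - f j) * (g i - g j) * ((f i + f j) * (g i + g j))"
      by (rule mult_nonneg_nonneg[OF sync[OF that]])
    also have "\<dots> = ((f i)\<^sup>2 - (f j)\<^sup>2) * ((g i)\<^sup>2 - (g j)\<^sup>2)"
      by (simp add: power2_eq_square square_diff_square_factored mult_ac)
    finally show ?thesis .
  qed
  have "vec_norm2 (A *\<^sub>v (B *\<^sub>v x)) = vec_norm2 (A * B *\<^sub>v x)"
    using A B x by (simp add: assoc_mult_mat_vec[of _ n n _ n])
  also have "\<dots> = (\<Sum>i<n. (f i)\<^sup>2 * (g i)\<^sup>2 * eig_weight U x i)"
    using vec_norm2_spectral[OF U(2,1) x ABe] by (simp add: power_mult_distrib)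
  finally show ?thesis
    using chebyshev_weighted[of n "eig_weight U x" "\<lambda>i. (f i)\<^sup>2" "\<lambda>i. (g i)\<^sup>2"] sync2
      vec_norm2_spectral[OF U(2,1) x Ae] vec_norm2_spectral[OF U(2,1) x Be] sum_eig_weight[OF U(2,1) x]
    by simp
qed

lemma monotone_pair_commute:
  assumes A: "A \<in> carrier_mat n n" and "psd_mat A" "psd_mat B" "monotone_pair A B"
  shows "A * B = B * A"
proof -
  from monotone_pair_simultaneous_diag[OF assms] obtain U f g where U: "U \<in> carrier_mat n n" "unitary_mat U"
    and Ae: "A = U * mat_diag n (\<lambda>i. complex_of_real (f i)) * mat_adjoint U"
    and Be: "B = U * mat_diag n (\<lambda>i. complex_of_real (g i)) * mat_adjoint U" by metis
  show ?thesis unfolding Ae Be spectral_mult[OF U(2,1)] by (simp add: mult.commute)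
qed

text \<open>In an eigenbasis of \<open>Z\<close> this is \<open>kantorovich_weighted\<close>, the
  eigenvalues of \<open>Z\<close> lying between \<open>b\<close> and \<open>a\<close>.\<close>

lemma kantorovich:
  assumes Z: "Z \<in> carrier_mat n n" and pd: "pd_mat Z"
    and ev: "\<And>x::real. eigenvalue Z (complex_of_real x) \<Longrightarrow> b \<le> x \<and> x \<le> a"
    and ab: "0 \<le> a * b" and u: "u \<in> carrier_vec n"
  shows "4 * (a * b) * (vec_norm2 u * vec_norm2 (Z *\<^sub>v u)) \<le> ((a + b) * Re ((Z *\<^sub>v u) \<bullet>c u))\<^sup>2"
proof -
  have h: "hermitian_mat Z" using pd by (simp add: pd_mat_def)
  obtain U d where sd: "spectral_decomp Z U d" and "antimono_on {..<n} d"
    by (rule hermitian_spectral_decomp_sorted[OF Z h])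
  note U = spectral_decompD[OF sd Z]
  have bnd: "b \<le> d i \<and> d i \<le> a" if "i < n" for i
  proof (rule ev)
    have "col U i \<noteq> 0\<^sub>v n" using unitary_diag_col(2)[OF U(2,1) that U(3)] by auto
    thus "eigenvalue Z (complex_of_real (d i))"
      using unitary_diag_col(1)[OF U(2,1) that U(3)] Z U(1)
      by (auto simp: eigenvalue_def eigenvector_def intro!: exI[of _ "col U i"])
  qed
  show ?thesis
    using kantorovich_weighted[of n "eig_weight U u" b d a] bnd ab
      vec_norm2_spectral[OF U(2,1) u U(3)] sum_eig_weight[OF U(2,1) u] quadratic_form_diag[OF U(1) u U(3)]
    by simp
qed

lemma pd_eigenvalue_pos:
  assumes Z: "Z \<in> carrier_mat n n" and pd: "pd_mat Z" and ev: "eigenvalue Z (complex_of_real x)"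
  shows "0 < x"
proof -
  from ev obtain v where v: "v \<in> carrier_vec n" "v \<noteq> 0\<^sub>v n" "Z *\<^sub>v v = complex_of_real x \<cdot>\<^sub>v v"
    using Z by (auto simp: eigenvalue_def eigenvector_def)
  have "0 < Re ((Z *\<^sub>v v) \<bullet>c v)" using pd v Z by (auto simp: pd_mat_def)
  also have "\<dots> = x * vec_norm2 v" using v by (simp add: cscalar_prod_self)
  finally show ?thesis using vec_norm2_pos[OF v(1,2)] by (simp add: zero_less_mult_iff)
qed

section \<open>Absolute values and the Loewner order in an eigenbasis\<close>

text \<open>Any diagonalisation of the Gram matrix may be used here, in particular a sorted one; the
  numbers \<open>sqrt (d i)\<close> for \<open>i < n\<close> are the singular values of
  \<open>X\<close>.\<close>

lemma mat_abs_spectral: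
  assumes X: "X \<in> carrier_mat n n" and "spectral_decomp (mat_adjoint X * X) U d"
  shows "mat_abs X = U * mat_diag n (\<lambda>i. complex_of_real (sqrt (d i))) * mat_adjoint U"
  using herm_fun_eq[OF assms(2)] X by (simp add: mat_abs_def)

lemma hermitian_gram:
  assumes X: "X \<in> carrier_mat m n"
  shows "hermitian_mat (mat_adjoint X * X)"
  using X mat_adjoint_carrier[OF X] by (simp add: hermitian_mat_def mat_adjoint_mult[of _ n m _ n])

text \<open>The difference is diagonal in the same basis, so its quadratic form is a sum of
  nonnegative terms.\<close>

lemma loewner_le_spectral:
  assumes U: "unitary_mat U" "U \<in> carrier_mat n n"
    and le: "\<And>i. i < n \<Longrightarrow> d i \<le> e i"
  shows "loewner_le (U * mat_diag n (\<lambda>i. complex_of_real (d i)) * mat_adjoint U)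
    (U * mat_diag n (\<lambda>i. complex_of_real (e i)) * mat_adjoint U)"
proof -
  note c = U(2) mat_adjoint_carrier[OF U(2)]
  have "U * mat_diag n (\<lambda>i. complex_of_real (e i)) * mat_adjoint U
      - U * mat_diag n (\<lambda>i. complex_of_real (d i)) * mat_adjoint U
    = U * (mat_diag n (\<lambda>i. complex_of_real (e i)) - mat_diag n (\<lambda>i. complex_of_real (d i))) * mat_adjoint U"
    using c by (simp add: minus_mult_distrib_mat[of _ n n _ _ n] mult_minus_distrib_mat[of _ n n _ n]
      mult_carrier_mat[of _ n n _ n])
  also have "mat_diag n (\<lambda>i. complex_of_real (e i)) - mat_diag n (\<lambda>i. complex_of_real (d i))
     = mat_diag n (\<lambda>i. complex_of_real (e i - d i))"
    by (intro eq_matI) (auto simp: mat_diag_def)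
  finally have diff: "U * mat_diag n (\<lambda>i. complex_of_real (e i)) * mat_adjoint U
      - U * mat_diag n (\<lambda>i. complex_of_real (d i)) * mat_adjoint U
    = U * mat_diag n (\<lambda>i. complex_of_real (e i - d i)) * mat_adjoint U" .
  have "psd_mat (U * mat_diag n (\<lambda>i. complex_of_real (e i - d i)) * mat_adjoint U)"
    unfolding psd_mat_def
  proof (intro conjI ballI)
    fix v :: "complex vec"
    assume "v \<in> carrier_vec (dim_row (U * mat_diag n (\<lambda>i. complex_of_real (e i - d i)) * mat_adjoint U))"
    hence v: "v \<in> carrier_vec n" using U(2) by simp
    show "0 \<le> Re ((U * mat_diag n (\<lambda>i. complex_of_real (e i - d i)) * mat_adjoint U *\<^sub>v v) \<bullet>c v)"
      unfolding quadratic_form_diag[OF U(2) v refl] Re_complex_of_real using le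
      by (intro sum_nonneg mult_nonneg_nonneg) auto
  qed (rule hermitian_spectral[OF U(2)])
  thus ?thesis unfolding loewner_le_def diff using hermitian_spectral[OF U(2)] U(2) by simp
qed

theorem theorem2p5:
  fixes A B Z :: "complex mat" and n :: nat and a b :: real
  assumes "A \<in> carrier_mat n n" and "B \<in> carrier_mat n n" and "Z \<in> carrier_mat n n"
    and "psd_mat A" and "psd_mat B" and "monotone_pair A B"
    and "pd_mat Z"
    and "eigenvalue Z (complex_of_real a)"
    and "\<And>x::real. eigenvalue Z (complex_of_real x) \<Longrightarrow> x \<le> a"
    and "eigenvalue Z (complex_of_real b)"
    and "\<And>x::real. eigenvalue Z (complex_of_real x) \<Longrightarrow> b \<le> x"
  shows "\<exists>V \<in> carrier_mat n n. unitary_mat V \<and>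
    loewner_le (mat_abs (Z * A * B))
      (complex_of_real ((a + b) / (2 * sqrt (a * b))) \<cdot>\<^sub>m
        (V * mat_abs (A * Z * B) * mat_adjoint V))"
proof -
  note A = assms(1) and B = assms(2) and Z = assms(3)
  have comm: "A * B = B * A" by (rule monotone_pair_commute[OF A assms(4-6)])
  have a: "0 < a" and b: "0 < b"
    using pd_eigenvalue_pos[OF Z assms(7)] assms(8,10) by auto
  define K where "K = (a + b) / (2 * sqrt (a * b))"
  have K: "0 \<le> K" using a b by (simp add: K_def)
  \<comment> \<open>Cleared of denominators, to match the constants in
    \<open>kantorovich\<close>.\<close>
  have K2: "K\<^sup>2 * (4 * (a * b)) = (a + b)\<^sup>2"
    using a b by (simp add: K_def power_divide power_mult_distrib)
  define X where "X = Z * A * B"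
  define Y where "Y = A * Z * B"
  have X: "X \<in> carrier_mat n n"
    and Y: "Y \<in> carrier_mat n n" using A B Z by (auto simp: X_def Y_def)
  have hA: "mat_adjoint A = A" using assms(4) by (auto simp: psd_mat_def hermitian_mat_def)
  have key: "vec_norm2 (X *\<^sub>v x) * vec_norm2 (A *\<^sub>v x) \<le> K\<^sup>2 * (vec_norm2 x * vec_norm2 (Y *\<^sub>v (A *\<^sub>v x)))"
    if x: "x \<in> carrier_vec n" for x
  proof -
    define u where "u = A *\<^sub>v (B *\<^sub>v x)"
    have u: "u \<in> carrier_vec n" using A B x by (simp add: u_def)
    have "u = A * B *\<^sub>v x" using A B x by (simp add: u_def assoc_mult_mat_vec[of _ n n _ n])
    also have "\<dots> = B *\<^sub>v (A *\<^sub>v x)" unfolding comm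
      by (rule assoc_mult_mat_vec[OF B A x])
    \<comment> \<open>Both forms of \<open>u\<close> matter: this one appears in
      \<open>Y *\<^sub>v (A *\<^sub>v x)\<close>, the other in \<open>X *\<^sub>v x\<close>.\<close>
    finally have u': "u = B *\<^sub>v (A *\<^sub>v x)" .
    have Xx: "X *\<^sub>v x = Z *\<^sub>v u"
      using A B Z x by (simp add: X_def u_def assoc_mult_mat_vec[of _ n n _ n] mult_carrier_mat[of _ n n _ n])
    have YA: "Y *\<^sub>v (A *\<^sub>v x) = A *\<^sub>v (Z *\<^sub>v u)"
      using A B Z x by (simp add: Y_def u' assoc_mult_mat_vec[of _ n n _ n] mult_carrier_mat[of _ n n _ n])
    \<comment> \<open>The Hermitian matrix \<open>A\<close> moves to the second factor and completes
      it to \<open>u\<close>.\<close>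
    have q: "(A *\<^sub>v (Z *\<^sub>v u)) \<bullet>c (B *\<^sub>v x) = (Z *\<^sub>v u) \<bullet>c u"
      using inner_mult_mat_vec[OF A, of "Z *\<^sub>v u" "B *\<^sub>v x"] A B Z u x
        by (simp add: hA u_def)
    have "(Re ((Z *\<^sub>v u) \<bullet>c u))\<^sup>2 \<le> (cmod ((Z *\<^sub>v u) \<bullet>c u))\<^sup>2"
      by (metis abs_Re_le_cmod abs_ge_zero power2_abs power_mono)
    also have "\<dots> \<le> vec_norm2 (Y *\<^sub>v (A *\<^sub>v x)) * vec_norm2 (B *\<^sub>v x)"
      using cauchy_schwarz_cscalar[of "A *\<^sub>v (Z *\<^sub>v u)" n "B *\<^sub>v x"] A B Z u x unfolding q YA by simp
    finally have cs: "(Re ((Z *\<^sub>v u) \<bullet>c u))\<^sup>2 \<le> vec_norm2 (Y *\<^sub>v (A *\<^sub>v x)) * vec_norm2 (B *\<^sub>v x)" .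
    have "4 * (a * b) * (vec_norm2 u * vec_norm2 (X *\<^sub>v x)) \<le> (a + b)\<^sup>2 * (Re ((Z *\<^sub>v u) \<bullet>c u))\<^sup>2"
      using kantorovich[OF Z assms(7) _ _ u, of b a] assms(9,11) a b
      unfolding Xx by (simp add: power_mult_distrib)
    also have "\<dots> = 4 * (a * b) * (K\<^sup>2 * (Re ((Z *\<^sub>v u) \<bullet>c u))\<^sup>2)" unfolding K2[symmetric] by simp
    finally have "vec_norm2 u * vec_norm2 (X *\<^sub>v x) \<le> K\<^sup>2 * (Re ((Z *\<^sub>v u) \<bullet>c u))\<^sup>2"
      using a b by simp
    also have "\<dots> \<le> K\<^sup>2 * (vec_norm2 (Y *\<^sub>v (A *\<^sub>v x)) * vec_norm2 (B *\<^sub>v x))"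
      using cs by (rule mult_left_mono) simp
    finally have 1: "vec_norm2 u * vec_norm2 (X *\<^sub>v x) \<le> K\<^sup>2 * (vec_norm2 (Y *\<^sub>v (A *\<^sub>v x)) * vec_norm2 (B *\<^sub>v x))" .
    have 2: "vec_norm2 (A *\<^sub>v x) * vec_norm2 (B *\<^sub>v x) \<le> vec_norm2 x * vec_norm2 u"
      using monotone_pair_chebyshev[OF A B assms(4-6) x] by (simp add: u_def)
    show ?thesis
    \<comment> \<open>Facts 1 and 2 combine to the goal multiplied by
      \<open>vec_norm2 (B *\<^sub>v x)\<close>. This factor cancels unless it is zero, and then
      \<open>X *\<^sub>v x\<close> vanishes.\<close>
    proof (cases "B *\<^sub>v x = 0\<^sub>v n")
      case True
      hence "X *\<^sub>v x = 0\<^sub>v n"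
        by (simp add: Xx u_def mult_mat_zero_vec[OF A] mult_mat_zero_vec[OF Z])
      thus ?thesis by simp
    next
      case False
      hence B0: "0 < vec_norm2 (B *\<^sub>v x)"
        using vec_norm2_pos[of "B *\<^sub>v x" n] B x by simp
      have "vec_norm2 (X *\<^sub>v x) * (vec_norm2 (A *\<^sub>v x) * vec_norm2 (B *\<^sub>v x))
          \<le> vec_norm2 (X *\<^sub>v x) * (vec_norm2 x * vec_norm2 u)"
        using 2 by (rule mult_left_mono) simp
      also have "\<dots> = vec_norm2 x * (vec_norm2 u * vec_norm2 (X *\<^sub>v x))" by simp
      also have "\<dots> \<le> vec_norm2 x * (K\<^sup>2 * (vec_norm2 (Y *\<^sub>v (A *\<^sub>v x)) * vec_norm2 (B *\<^sub>v x)))"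
        using 1 by (rule mult_left_mono) simp
      finally have "(vec_norm2 (X *\<^sub>v x) * vec_norm2 (A *\<^sub>v x)) * vec_norm2 (B *\<^sub>v x)
          \<le> (K\<^sup>2 * (vec_norm2 x * vec_norm2 (Y *\<^sub>v (A *\<^sub>v x)))) * vec_norm2 (B *\<^sub>v x)"
        by (simp add: mult_ac)
      thus ?thesis using B0 by simp
    qed
  qed
  \<comment> \<open>Commuting \<open>A\<close> and \<open>B\<close> puts \<open>A\<close> rightmost
    in \<open>X\<close>, so the kernel of \<open>A\<close> lies in that of \<open>X\<close>.\<close>
  have inj: "X *\<^sub>v x = 0\<^sub>v n" if "x \<in> carrier_vec n" "A *\<^sub>v x = 0\<^sub>v n" for x
  proof -
    have "X = Z * (B * A)" unfolding X_def comm[symmetric] by (rule assoc_mult_mat[OF Z A B])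
    thus ?thesis using that A B Z
      by (simp add: assoc_mult_mat_vec[of _ n n _ n] mult_carrier_mat[of _ n n _ n]
          mult_mat_zero_vec[of _ n n])
  qed
  have cX: "mat_adjoint X * X \<in> carrier_mat n n" "mat_adjoint Y * Y \<in> carrier_mat n n"
    using X Y mat_adjoint_carrier by auto
  obtain U d where U: "spectral_decomp (mat_adjoint X * X) U d" and d: "antimono_on {..<n} d"
    by (rule hermitian_spectral_decomp_sorted[OF cX(1) hermitian_gram[OF X]])
  obtain W e where W: "spectral_decomp (mat_adjoint Y * Y) W e" and e: "antimono_on {..<n} e"
    by (rule hermitian_spectral_decomp_sorted[OF cX(2) hermitian_gram[OF Y]])
  note uU = spectral_decompD(1,2)[OF U cX(1)] and uW = spectral_decompD(1,2)[OF W cX(2)]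
  \<comment> \<open>The min-max comparison with \<open>A\<close> in the role of \<open>T\<close> and
    \<open>K\<^sup>2\<close> as the constant.\<close>
  have le: "d k \<le> K\<^sup>2 * e k" if "k < n" for k
    by (rule spectral_le_of_norm_le[OF X Y A U W d e zero_le_power2 inj key that])
  have sle: "sqrt (d k) \<le> K * sqrt (e k)" if "k < n" for k
    using real_sqrt_le_mono[OF le[OF that]] K by (simp add: real_sqrt_mult)
  \<comment> \<open>\<open>V\<close> carries the \<open>i\<close>-th column of \<open>W\<close> to
    the \<open>i\<close>-th column of \<open>U\<close>, so conjugation by it makes
    \<open>mat_abs Y\<close> diagonal in the eigenbasis of \<open>mat_abs X\<close>, with both
    spectra in decreasing order.\<close>
  define V where "V = U * mat_adjoint W"
  have W': "mat_adjoint W \<in> carrier_mat n n" "unitary_mat (mat_adjoint W)"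
    using mat_adjoint_carrier unitary_mat_adjoint uW by auto
  have U': "mat_adjoint U \<in> carrier_mat n n" using mat_adjoint_carrier uU by auto
  have V: "V \<in> carrier_mat n n" "unitary_mat V"
    using unitary_mat_mult[OF uU(2,1) W'(2,1)] uU W' by (auto simp: V_def)
  define D where "D = mat_diag n (\<lambda>i. complex_of_real (sqrt (e i)))"
  have D: "D \<in> carrier_mat n n" by (simp add: D_def)
  have "V * mat_abs Y * mat_adjoint V = U * ((mat_adjoint W * W) * (D * ((mat_adjoint W * W) * mat_adjoint U)))"
    unfolding mat_abs_spectral[OF Y W] D_def[symmetric] using uU uW U' W' D
    by (simp add: V_def mat_adjoint_mult[of _ n n _ n] assoc_mult_mat[of _ n n _ n _ n] mult_carrier_mat[of _ n n _ n])
  also have "\<dots> = U * D * mat_adjoint U"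
    using unitary_matD[OF uW(2,1)] uU U' D
    by (simp add: assoc_mult_mat[of _ n n _ n _ n] left_mult_one_mat[of _ n n] mult_carrier_mat[of _ n n _ n])
  finally have "complex_of_real K \<cdot>\<^sub>m (V * mat_abs Y * mat_adjoint V) = complex_of_real K \<cdot>\<^sub>m (U * D * mat_adjoint U)"
    by simp
  also have "\<dots> = U * (complex_of_real K \<cdot>\<^sub>m D) * mat_adjoint U"
    using uU U' D by (simp add: mult_smult_distrib[of _ n n _ n] mult_smult_assoc_mat[of _ n n _ n] mult_carrier_mat[of _ n n _ n])
  also have "complex_of_real K \<cdot>\<^sub>m D = mat_diag n (\<lambda>i. complex_of_real (K * sqrt (e i)))"
    by (intro eq_matI) (auto simp: D_def mat_diag_def)
  finally have "loewner_le (mat_abs X) (complex_of_real K \<cdot>\<^sub>m (V * mat_abs Y * mat_adjoint V))"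
    using loewner_le_spectral[OF uU(2,1) sle] by (simp add: mat_abs_spectral[OF X U])
  thus ?thesis using V unfolding X_def Y_def K_def by blast
qed

end
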